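(* Let $W$ be the Weyl group of type $E_8$ with simple reflections $S=\{s_1,\dots,s_8\}$ and root system $\Phi$, let $I'=S\setminus\{s_7,s_8\}$ (so $W_{I'}\cong W(E_6)$), and let $U'\subseteq\Phi$ be the set of all (positive) roots of $8$-height $0$ and $7$-height $1$. Then $(W,I',U')$ is a QP-triple; that is, $\Omega_{U'}$ is a quasiparabolic $W_{I'}$-set with respect to the level function $\rho_{U'}$.
   Context: $\Phi$ is the root system of type $E_8$ with simple roots $\alpha_1,\dots,\alpha_8$ labelled so that $\alpha_1,\alpha_3,\alpha_4,\alpha_5,\alpha_6,\alpha_7,\alpha_8$ form a path in the Dynkin diagram in this order and $\alpha_2$ is joined only to $\alpha_4$; $B$ is the invariant form with $B(\alpha_i,\alpha_i)=2$, $-1$ for adjacent nodes, $0$ otherwise; $s_\alpha(\beta)=\beta-B(\alpha,\beta)\alpha$, $s_i=s_{\alpha_i}$, $W_J=\langle J\rangle$. The $i$-height of $\alpha=\sum c_j\alpha_j$ is $c_i$. For a root $\alpha$, $|\alpha|$ is the positive root among $\pm\alpha$; the standard action is $w\cdot R=\{|w(\alpha)|:\alpha\in R\}$. For $U\subseteq\Phi_+$: $\kappa$ is the maximal size of a pairwise orthogonal subset of $U$, $\Omega_U$ the set of pairwise orthogonal subsets of $U$ of size $\kappa$; $\mathrm{Res}_U(R)=\{\gamma\in U:s_\beta(\gamma)\in\Phi_+\ \forall\beta\in R\}$, $\rho_U(R)=|\mathrm{Res}_U(R)|$. Quasiparabolic sets: for a Coxeter system $(W',S')$ with reflections $T'$,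 a scaled $W'$-set is a $W'$-set $X$ with $\lambda:X\to\mathbb Z$, $|\lambda(sx)-\lambda(x)|\le1$ for $s\in S'$; quasiparabolic if (QP1) $r\in T'$, $\lambda(rx)=\lambda(x)\Rightarrow rx=x$; (QP2) $r\in T'$, $s\in S'$, $\lambda(rx)>\lambda(x)$ and $\lambda(srx)<\lambda(sx)\Rightarrow rx=sx$. $(W,I,U)$ is a QP-triple if $\Omega_U$ is a quasiparabolic $W_I$-set under the restricted standard action with level $\rho_U$. *)

theory Defs
  imports
    "HOL-Algebra.Generated_Groups"
    "HOL-Algebra.Group_Action"
    "HOL-Analysis.Finite_Cartesian_Product"
    "HOL-Library.Numeral_Type"
begin

section \<open>Quasiparabolic sets\<close>

definition conjugate_reflections :: "('g, 'm) monoid_scheme \<Rightarrow> 'g set \<Rightarrow> 'g set" where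
  "conjugate_reflections G S =
     {w \<otimes>\<^bsub>G\<^esub> s \<otimes>\<^bsub>G\<^esub> inv\<^bsub>G\<^esub> w | w s. w \<in> carrier G \<and> s \<in> S}"

text \<open>
  In the following definitions \<open>(G, S)\<close> is meant to be a Coxeter system; its reflections are the
  conjugates of the elements of \<open>S\<close>. The conditions themselves mention only the group, its
  generators and its reflections, so being a Coxeter system is not repeated as a condition.
\<close>

definition scaled_set ::
    "('g, 'm) monoid_scheme \<Rightarrow> 'g set \<Rightarrow> 'x set \<Rightarrow> ('g \<Rightarrow> 'x \<Rightarrow> 'x) \<Rightarrow> ('x \<Rightarrow> int) \<Rightarrow> bool" where
  "scaled_set G S X act lev \<longleftrightarrow>
     group_action G X act \<and>
     S \<subseteq> carrier G \<and> generate G S = carrier G \<and>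
     (\<forall>s\<in>S. \<forall>x\<in>X. \<bar>lev (act s x) - lev x\<bar> \<le> 1)"

definition quasiparabolic ::
    "('g, 'm) monoid_scheme \<Rightarrow> 'g set \<Rightarrow> 'x set \<Rightarrow> ('g \<Rightarrow> 'x \<Rightarrow> 'x) \<Rightarrow> ('x \<Rightarrow> int) \<Rightarrow> bool" where
  "quasiparabolic G S X act lev \<longleftrightarrow>
     scaled_set G S X act lev \<and>
     (\<forall>r\<in>conjugate_reflections G S. \<forall>x\<in>X. lev (act r x) = lev x \<longrightarrow> act r x = x) \<and>
     (\<forall>r\<in>conjugate_reflections G S. \<forall>s\<in>S. \<forall>x\<in>X.
        lev (act r x) > lev x \<and> lev (act s (act r x)) < lev (act s x) \<longrightarrow> act r x = act s x)"

section \<open>The root system of type $E_8$\<close>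

text \<open>
  A vector of type \<^typ>\<open>int ^ 8\<close> is an element of the root lattice, given by its coefficients with
  respect to the simple roots. The index type \<^typ>\<open>8\<close> consists of the eight elements
  \<open>1, 2, \<dots>, 8\<close>, with arithmetic modulo 8, so that its element \<open>8\<close> is also denoted \<open>0\<close>.
\<close>

type_synonym lattice = "int ^ 8"

definition adjacent :: "8 \<Rightarrow> 8 \<Rightarrow> bool" where
  "adjacent i j \<longleftrightarrow> {i, j} \<in> {{1, 3}, {3, 4}, {4, 5}, {5, 6}, {6, 7}, {7, 8}, {2, 4}}"

definition cartan :: "8 \<Rightarrow> 8 \<Rightarrow> int" where
  "cartan i j = (if i = j then 2 else if adjacent i j then - 1 else 0)"

definition B :: "lattice \<Rightarrow> lattice \<Rightarrow> int" where
  "B x y = (\<Sum>i\<in>UNIV. \<Sum>j\<in>UNIV. x $ i * y $ j * cartan i j)"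

definition simple_root :: "8 \<Rightarrow> lattice" where
  "simple_root i = axis i 1"

definition refl_in :: "lattice \<Rightarrow> lattice \<Rightarrow> lattice" where
  "refl_in \<alpha> \<beta> = \<beta> - B \<alpha> \<beta> *s \<alpha>"

definition simple_refl :: "8 \<Rightarrow> lattice \<Rightarrow> lattice" where
  "simple_refl i = refl_in (simple_root i)"

definition S :: "(lattice \<Rightarrow> lattice) set" where
  "S = range simple_refl"

text \<open>The multiplication of \<^term>\<open>BijGroup UNIV\<close> is composition of functions.\<close>

definition W :: "(lattice \<Rightarrow> lattice) set \<Rightarrow> (lattice \<Rightarrow> lattice) monoid" where
  "W J = subgroup_generated (BijGroup UNIV) J"

definition roots :: "lattice set" where
  "roots = {w (simple_root i) | w i. w \<in> carrier (W S)}"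

definition pos_roots :: "lattice set" where
  "pos_roots = {\<alpha> \<in> roots. \<forall>i. \<alpha> $ i \<ge> 0}"

definition height :: "8 \<Rightarrow> lattice \<Rightarrow> int" where
  "height i \<alpha> = \<alpha> $ i"

definition abs_root :: "lattice \<Rightarrow> lattice" where
  "abs_root \<alpha> = (if \<alpha> \<in> pos_roots then \<alpha> else - \<alpha>)"

definition std_act :: "(lattice \<Rightarrow> lattice) \<Rightarrow> lattice set \<Rightarrow> lattice set" where
  "std_act w R = (\<lambda>\<alpha>. abs_root (w \<alpha>)) ` R"

section \<open>QP-triples\<close>

definition orthogonal_sets :: "lattice set \<Rightarrow> lattice set set" where
  "orthogonal_sets U = {R. R \<subseteq> U \<and> pairwise (\<lambda>\<alpha> \<beta>. B \<alpha> \<beta> = 0) R}"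

definition kappa :: "lattice set \<Rightarrow> nat" where
  "kappa U = Max (card ` orthogonal_sets U)"

definition Omega :: "lattice set \<Rightarrow> lattice set set" where
  "Omega U = {R \<in> orthogonal_sets U. card R = kappa U}"

definition Res :: "lattice set \<Rightarrow> lattice set \<Rightarrow> lattice set" where
  "Res U R = {\<gamma> \<in> U. \<forall>\<beta>\<in>R. refl_in \<beta> \<gamma> \<in> pos_roots}"

definition rho :: "lattice set \<Rightarrow> lattice set \<Rightarrow> nat" where
  "rho U R = card (Res U R)"

text \<open>
  The parameter \<open>J\<close> is a set of simple reflections. The action is cut down to \<^term>\<open>Omega U\<close> with
  \<^const>\<open>restrict\<close> because \<^const>\<open>group_action\<close> requires extensional functions; it is part of
  the claim that \<^term>\<open>Omega U\<close> is stable under the group.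
\<close>

definition QP_triple :: "(lattice \<Rightarrow> lattice) set \<Rightarrow> lattice set \<Rightarrow> bool" where
  "QP_triple J U \<longleftrightarrow>
     J \<subseteq> S \<and> U \<subseteq> pos_roots \<and>
     quasiparabolic (W J) J (Omega U) (\<lambda>w. restrict (std_act w) (Omega U)) (\<lambda>R. int (rho U R))"

end

theory Submission
  imports Defs
begin

text \<open>
  The set \<open>U'\<close> consists of the 27 weights of a minuscule representation of \<open>E\<^sub>6\<close>, and its maximal
  orthogonal subsets are the 45 triples that correspond to the tritangent planes of a cubic surface.
  A simple reflection moves at most two members of such a triple. Conjugation carries this over to
  all reflections \<open>r\<close>, so that \<open>R\<close> and \<open>r \<cdot> R\<close> always have a common member. Both axioms of a
  quasiparabolic set thus follow from statements about pairs of intersecting triples that involve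
  simple reflections only and that are decided by computation with the coefficients of the 27 roots.
\<close>

section \<open>Isometries of the root lattice\<close>

lemma UNIV_8: "(UNIV :: 8 set) = {1, 2, 3, 4, 5, 6, 7, 8}"
proof -
  have "x \<in> {1, 2, 3, 4, 5, 6, 7, 8}" for x :: 8
  proof (induct x)
    case (of_int z)
    then have "0 \<le> z" "z < 8" by simp_all
    \<comment> \<open>The case 0 is the index \<open>8\<close>, since arithmetic is modulo
      8.\<close>
    then have "z = 0 \<or> z = 1 \<or> z = 2 \<or> z = 3 \<or> z = 4 \<or> z = 5 \<or> z = 6 \<or> z = 7" by arith
    then show ?case by auto
  qed
  then show ?thesis by blast
qed

lemma all_8: "(\<forall>i :: 8. P i) \<longleftrightarrow> P 1 \<and> P 2 \<and> P 3 \<and> P 4 \<and> P 5 \<and> P 6 \<and> P 7 \<and> P 8"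
proof -
  have "(\<forall>i. P i) \<longleftrightarrow> (\<forall>i\<in>{1, 2, 3, 4, 5, 6, 7, 8 :: 8}. P i)"
    by (metis UNIV_8 UNIV_I)
  then show ?thesis by simp
qed

lemma sum_8: "sum f (UNIV :: 8 set) = f 1 + f 2 + f 3 + f 4 + f 5 + f 6 + f 7 + (f 8 :: int)"
  unfolding UNIV_8 by (simp add: eq_numeral_iff_iszero)

lemma B_coordinates:
  "B x y =
     2 * (x$1 * y$1 + x$2 * y$2 + x$3 * y$3 + x$4 * y$4 + x$5 * y$5 + x$6 * y$6 + x$7 * y$7 + x$8 * y$8)
     - (x$1 * y$3 + x$3 * y$1) - (x$3 * y$4 + x$4 * y$3) - (x$2 * y$4 + x$4 * y$2)
     - (x$4 * y$5 + x$5 * y$4) - (x$5 * y$6 + x$6 * y$5) - (x$6 * y$7 + x$7 * y$6)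
     - (x$7 * y$8 + x$8 * y$7)"
  unfolding B_def sum_8 cartan_def adjacent_def
  by (simp add: doubleton_eq_iff eq_numeral_iff_iszero)

lemma B_simple_root: "B (simple_root i) (simple_root i) = 2"
proof -
  have "\<forall>i. B (simple_root i) (simple_root i) = 2"
    unfolding all_8 B_coordinates simple_root_def axis_def
    by (simp add: eq_numeral_iff_iszero)
  then show ?thesis by blast
qed

lemma B_commute: "B x y = B y x"
  by (simp add: B_coordinates algebra_simps)

lemma B_diff_scale_right: "B x (y - c *s z) = B x y - c * B x z"
  by (simp add: B_coordinates algebra_simps)

lemma B_diff_scale_left: "B (y - c *s z) x = B y x - c * B z x"
  by (simp add: B_coordinates algebra_simps)

text \<open>The first clause is linearity in a single equation, in the shape that
  \<open>refl_in\<close> has, so that it rewrites reflections directly.\<close>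

definition lattice_isometry :: "(lattice \<Rightarrow> lattice) \<Rightarrow> bool" where
  "lattice_isometry w \<longleftrightarrow>
     (\<forall>c x y. w (x - c *s y) = w x - c *s w y) \<and> (\<forall>x y. B (w x) (w y) = B x y)"

lemma lattice_isometry_id: "lattice_isometry (\<lambda>x. x)"
  by (simp add: lattice_isometry_def)

lemma lattice_isometry_comp:
  "lattice_isometry v \<Longrightarrow> lattice_isometry w \<Longrightarrow> lattice_isometry (v \<circ> w)"
  by (simp add: lattice_isometry_def)

lemma lattice_isometry_refl_in:
  assumes "B \<alpha> \<alpha> = 2"
  shows "lattice_isometry (refl_in \<alpha>)"
  unfolding lattice_isometry_def refl_in_def
proof (intro conjI allI)
  show "x - c *s y - B \<alpha> (x - c *s y) *s \<alpha> = x - B \<alpha> x *s \<alpha> - c *s (y - B \<alpha> y *s \<alpha>)" for c x y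
    by (simp add: vec_eq_iff B_diff_scale_right algebra_simps)
  show "B (x - B \<alpha> x *s \<alpha>) (y - B \<alpha> y *s \<alpha>) = B x y" for x y
    by (simp add: B_diff_scale_right B_diff_scale_left assms B_commute[of x \<alpha>] algebra_simps)
qed

lemma refl_in_involution:
  assumes "B \<alpha> \<alpha> = 2"
  shows "refl_in \<alpha> (refl_in \<alpha> x) = x"
  by (simp add: refl_in_def vec_eq_iff B_diff_scale_right assms algebra_simps)

lemma S_reflection:
  assumes "s \<in> S"
  shows "lattice_isometry s" "s \<circ> s = (\<lambda>x. x)" "bij s"
proof -
  obtain i where s: "s = refl_in (simple_root i)"
    using assms by (auto simp: S_def simple_refl_def)
  show "lattice_isometry s"
    by (simp add: s lattice_isometry_refl_in B_simple_root)
  show inv: "s \<circ> s = (\<lambda>x. x)"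
    by (rule ext) (simp add: s refl_in_involution B_simple_root)
  show "bij s"
    using inv by (intro o_bij[of s s]) (simp_all add: id_def)
qed

section \<open>Groups generated by simple reflections, as groups of lattice maps\<close>

lemma carrier_BijGroup_UNIV: "carrier (BijGroup UNIV) = {f. bij f}"
  by (auto simp: BijGroup_def Bij_def)

lemma mult_BijGroup_UNIV:
  "bij f \<Longrightarrow> bij g \<Longrightarrow> f \<otimes>\<^bsub>BijGroup UNIV\<^esub> g = f \<circ> g"
  by (auto simp: BijGroup_def Bij_def compose_def)

lemma one_BijGroup_UNIV: "\<one>\<^bsub>BijGroup UNIV\<^esub> = (\<lambda>x. x)"
  by (simp add: BijGroup_def restrict_def)

lemma group_W: "group (W J)"
  by (simp add: W_def group.group_subgroup_generated group_BijGroup)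

lemma bij_W: "w \<in> carrier (W J) \<Longrightarrow> bij w"
  using group.carrier_subgroup_generated_subset[OF group_BijGroup]
  by (fastforce simp: W_def carrier_BijGroup_UNIV)

lemma mult_W:
  "v \<in> carrier (W J) \<Longrightarrow> w \<in> carrier (W J) \<Longrightarrow> v \<otimes>\<^bsub>W J\<^esub> w = v \<circ> w"
  using bij_W[of v J] bij_W[of w J] by (simp add: W_def mult_BijGroup_UNIV)

lemma one_W: "\<one>\<^bsub>W J\<^esub> = (\<lambda>x. x)"
  by (simp add: W_def one_BijGroup_UNIV)

lemma comp_inv_W:
  assumes "w \<in> carrier (W J)"
  shows "w \<circ> inv\<^bsub>W J\<^esub> w = (\<lambda>x. x)" "inv\<^bsub>W J\<^esub> w \<circ> w = (\<lambda>x. x)"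
proof -
  have inv: "inv\<^bsub>W J\<^esub> w \<in> carrier (W J)"
    using assms group_W by (simp add: group.inv_closed)
  show "w \<circ> inv\<^bsub>W J\<^esub> w = (\<lambda>x. x)"
    using group.r_inv[OF group_W assms] mult_W[OF assms inv] one_W by metis
  show "inv\<^bsub>W J\<^esub> w \<circ> w = (\<lambda>x. x)"
    using group.l_inv[OF group_W assms] mult_W[OF inv assms] one_W by metis
qed

text \<open>\<open>subgroup_generated\<close> cuts its generators down to the carrier, so they must
  first be seen to be bijections.\<close>

lemma generators_W:
  assumes "J \<subseteq> S"
  shows "J \<subseteq> carrier (W J)" "generate (W J) J = carrier (W J)"
proof -
  interpret group "BijGroup (UNIV :: lattice set)" by (rule group_BijGroup)
  have J: "J \<subseteq> carrier (BijGroup UNIV)"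
    using assms S_reflection(3) by (auto simp: carrier_BijGroup_UNIV)
  show 1: "J \<subseteq> carrier (W J)"
    unfolding W_def using J by (rule subgroup_generated_subset_carrier_subset)
  have "subgroup_generated (W J) J = W J"
    unfolding W_def by (rule subgroup_generated2)
  then have "carrier (subgroup_generated (W J) J) = carrier (W J)" by simp
  then show "generate (W J) J = carrier (W J)"
    using 1 by (simp add: carrier_subgroup_generated Int_absorb1)
qed

text \<open>Inverses give no separate case: the generators are involutions, hence their own
  inverses.\<close>

lemma W_induct [consumes 2, case_names id reflection comp]:
  assumes "J \<subseteq> S" "w \<in> carrier (W J)"
    and "P (\<lambda>x. x)" "\<And>s. s \<in> J \<Longrightarrow> P s"
    and "\<And>v w. v \<in> carrier (W J) \<Longrightarrow> w \<in> carrier (W J) \<Longrightarrow> P v \<Longrightarrow> P w \<Longrightarrow> P (v \<circ> w)"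
  shows "P w"
proof -
  have "w \<in> generate (W J) J"
    using generators_W(2)[OF assms(1)] assms(2) by simp
  then show ?thesis
  proof induction
    case one
    then show ?case using assms(3) by (simp add: one_W)
  next
    case (incl s)
    then show ?case using assms(4) by simp
  next
    case (inv s)
    then have s: "s \<in> carrier (W J)" using generators_W(1)[OF assms(1)] by blast
    have "s \<otimes>\<^bsub>W J\<^esub> s = \<one>\<^bsub>W J\<^esub>"
      using inv assms(1) S_reflection(2) by (simp add: mult_W[OF s s] one_W subset_iff)
    then have "inv\<^bsub>W J\<^esub> s = s"
      using group.inv_equality[OF group_W] s by blast
    then show ?case using assms(4) inv by simp
  next
    case (eng v w)
    then have "v \<in> carrier (W J)" "w \<in> carrier (W J)"
      using generators_W(2)[OF assms(1)] by auto
    then show ?case using eng.IH assms(5) mult_W by metis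
  qed
qed

lemma lattice_isometry_W:
  assumes "J \<subseteq> S" "w \<in> carrier (W J)"
  shows "lattice_isometry w"
  using assms
proof (induction rule: W_induct)
  case (reflection s)
  then show ?case using assms(1) S_reflection(1) by blast
qed (rule lattice_isometry_id, rule lattice_isometry_comp)

section \<open>The roots under the Weyl group\<close>

lemma simple_root_in_roots: "simple_root i \<in> roots"
proof -
  have "(\<lambda>x. x) \<in> carrier (W S)"
    using group.is_monoid[OF group_W, THEN monoid.one_closed] by (simp add: one_W)
  then show ?thesis unfolding roots_def by force
qed

lemma W_roots:
  assumes "w \<in> carrier (W S)" "\<alpha> \<in> roots"
  shows "w \<alpha> \<in> roots"
proof -
  obtain v i where "v \<in> carrier (W S)" "\<alpha> = v (simple_root i)"
    using assms(2) by (auto simp: roots_def)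
  moreover from this have "w \<circ> v \<in> carrier (W S)"
    using mult_W[OF assms(1)] group_W assms(1) by (metis group.is_monoid monoid.m_closed)
  ultimately show ?thesis
    unfolding roots_def by (intro CollectI exI[of _ "w \<circ> v"] exI[of _ i]) simp
qed

lemma B_root: "\<alpha> \<in> roots \<Longrightarrow> B \<alpha> \<alpha> = 2"
  using lattice_isometry_W[of S] B_simple_root by (auto simp: roots_def lattice_isometry_def)

text \<open>As w is an isometry, the reflection in w(\<alpha>_i) is the conjugate of s_i by w, a
  composition of maps that preserve the roots.\<close>

lemma refl_in_roots:
  assumes "\<alpha> \<in> roots" "\<beta> \<in> roots"
  shows "refl_in \<alpha> \<beta> \<in> roots"
proof -
  obtain w i where w: "w \<in> carrier (W S)" and \<alpha>: "\<alpha> = w (simple_root i)"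
    using assms(1) by (auto simp: roots_def)
  define v where "v = inv\<^bsub>W S\<^esub> w"
  have v: "v \<in> carrier (W S)"
    using w group_W by (simp add: v_def group.inv_closed)
  have wv: "w (v x) = x" for x
    using comp_inv_W(1)[OF w] by (metis comp_apply v_def)
  have iso: "lattice_isometry w"
    using lattice_isometry_W w by blast
  have "refl_in \<alpha> \<beta> = w (simple_refl i (v \<beta>))"
    using iso wv[of \<beta>] unfolding simple_refl_def refl_in_def \<alpha> lattice_isometry_def by metis
  moreover have "simple_refl i \<in> carrier (W S)"
    using generators_W(1)[of S] by (auto simp: S_def)
  ultimately show ?thesis
    using W_roots w v assms(2) by simp
qed

section \<open>A criterion for QP-triples\<close>

text \<open>While w keeps \<open>U\<close> among the positive roots, \<open>abs_root\<close> changes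
  nothing.\<close>

lemma std_act_eq_image:
  assumes "w ` U \<subseteq> pos_roots" "R \<subseteq> U"
  shows "std_act w R = w ` R"
  unfolding std_act_def using assms by (intro image_cong) (auto simp: abs_root_def)

lemma image_Omega:
  assumes "lattice_isometry w" "bij w" "w ` U \<subseteq> U" "R \<in> Omega U"
  shows "w ` R \<in> Omega U"
proof -
  have "inj_on w R"
    using assms(2) by (meson bij_is_inj inj_on_subset subset_UNIV)
  moreover have "pairwise (\<lambda>\<alpha> \<beta>. B \<alpha> \<beta> = 0) (w ` R)"
    using assms(1,4) unfolding Omega_def orthogonal_sets_def lattice_isometry_def pairwise_def
    by auto
  ultimately show ?thesis
    using assms(3,4) by (auto simp: Omega_def orthogonal_sets_def card_image)
qed

text \<open>A reflection r occurs in the axioms only through the image of R under r, so any T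
  meeting R may stand in for that image. Common members are required for simple reflections only;
  conjugates inherit them.\<close>

lemma QP_triple_criterion:
  assumes J: "J \<subseteq> S" and U: "U \<subseteq> pos_roots"
    and stable: "\<And>s. s \<in> J \<Longrightarrow> s ` U \<subseteq> U"
    and level_step: "\<And>s R. s \<in> J \<Longrightarrow> R \<in> Omega U \<Longrightarrow> \<bar>int (rho U (s ` R)) - int (rho U R)\<bar> \<le> 1"
    and meets: "\<And>s R. s \<in> J \<Longrightarrow> R \<in> Omega U \<Longrightarrow> R \<inter> s ` R \<noteq> {}"
    and qp1: "\<And>R T. R \<in> Omega U \<Longrightarrow> T \<in> Omega U \<Longrightarrow> R \<inter> T \<noteq> {} \<Longrightarrow> rho U T = rho U R \<Longrightarrow> T = R"
    and qp2: "\<And>s R T. s \<in> J \<Longrightarrow> R \<in> Omega U \<Longrightarrow> T \<in> Omega U \<Longrightarrow> R \<inter> T \<noteq> {} \<Longrightarrow>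
        rho U R < rho U T \<Longrightarrow> rho U (s ` T) < rho U (s ` R) \<Longrightarrow> T = s ` R"
  shows "QP_triple J U"
proof -
  have W_stable: "w ` U \<subseteq> U" if "w \<in> carrier (W J)" for w
    using J that
  proof (induction rule: W_induct)
    case (comp v w)
    then show ?case unfolding image_comp[symmetric] by (meson image_mono subset_trans)
  qed (use stable in auto)
  have W_Omega: "w ` R \<in> Omega U" if "w \<in> carrier (W J)" "R \<in> Omega U" for w R
    by (rule image_Omega[OF lattice_isometry_W[OF J that(1)] bij_W[OF that(1)] W_stable[OF that(1)] that(2)])
  have act: "restrict (std_act w) (Omega U) R = w ` R" if "w \<in> carrier (W J)" "R \<in> Omega U" for w R
  proof -
    have "R \<subseteq> U" using that(2) by (simp add: Omega_def orthogonal_sets_def)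
    then show ?thesis
      using std_act_eq_image[of w U R] W_stable[OF that(1)] U that(2) by auto
  qed
  have inv_W: "inv\<^bsub>W J\<^esub> w \<in> carrier (W J)" if "w \<in> carrier (W J)" for w
    using that group_W by (simp add: group.inv_closed)
  have J_W: "s \<in> carrier (W J)" if "s \<in> J" for s
    using generators_W(1)[OF J] that by blast
  have "restrict (std_act w) (Omega U) \<in> Bij (Omega U)" if w: "w \<in> carrier (W J)" for w
  proof -
    let ?v = "inv\<^bsub>W J\<^esub> w"
    have "bij_betw (\<lambda>R. w ` R) (Omega U) (Omega U)"
    proof (rule bij_betw_byWitness[where f' = "\<lambda>R. ?v ` R"])
      show "\<forall>R\<in>Omega U. ?v ` w ` R = R" "\<forall>R\<in>Omega U. w ` ?v ` R = R"
        using comp_inv_W[OF w] by (simp_all add: image_comp)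
    qed (use W_Omega w inv_W in auto)
    then have "bij_betw (restrict (std_act w) (Omega U)) (Omega U) (Omega U)"
      using bij_betw_cong[of "Omega U" "restrict (std_act w) (Omega U)" "\<lambda>R. w ` R"] act[OF w]
      by blast
    then show ?thesis by (simp add: Bij_def)
  qed
  note act_Bij = this
  have action: "group_action (W J) (Omega U) (\<lambda>w. restrict (std_act w) (Omega U))"
    unfolding group_action_def group_hom_def group_hom_axioms_def
  proof (intro conjI homI)
    show "group (W J)" "group (BijGroup (Omega U))"
      by (rule group_W, rule group_BijGroup)
    show "restrict (std_act w) (Omega U) \<in> carrier (BijGroup (Omega U))" if "w \<in> carrier (W J)" for w
      using act_Bij[OF that] by (simp add: BijGroup_def)
    fix v w assume v: "v \<in> carrier (W J)" and w: "w \<in> carrier (W J)"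
    then have vw: "v \<circ> w \<in> carrier (W J)"
      using mult_W group_W by (metis group.is_monoid monoid.m_closed)
    have "restrict (std_act (v \<circ> w)) (Omega U)
        = compose (Omega U) (restrict (std_act v) (Omega U)) (restrict (std_act w) (Omega U))"
    \<comment> \<open>Both sides are extensional on \<open>Omega U\<close>, so agreement there
      suffices.\<close>
    proof (rule extensionalityI[of _ "Omega U"])
      fix R assume R: "R \<in> Omega U"
      show "restrict (std_act (v \<circ> w)) (Omega U) R
        = compose (Omega U) (restrict (std_act v) (Omega U)) (restrict (std_act w) (Omega U)) R"
        unfolding compose_eq[OF R] act[OF vw R] act[OF w R] act[OF v W_Omega[OF w R]]
        by (simp add: image_comp)
    qed simp_all
    then show "restrict (std_act (v \<otimes>\<^bsub>W J\<^esub> w)) (Omega U)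
        = restrict (std_act v) (Omega U) \<otimes>\<^bsub>BijGroup (Omega U)\<^esub> restrict (std_act w) (Omega U)"
      using act_Bij v w by (simp add: mult_W BijGroup_def)
  qed
  have reflection: "r \<in> carrier (W J)" "R \<inter> r ` R \<noteq> {}"
    if r: "r \<in> conjugate_reflections (W J) J" and R: "R \<in> Omega U" for r R
  proof -
    obtain w s where w: "w \<in> carrier (W J)" and s: "s \<in> J"
      and r: "r = w \<otimes>\<^bsub>W J\<^esub> s \<otimes>\<^bsub>W J\<^esub> inv\<^bsub>W J\<^esub> w"
      using r by (auto simp: conjugate_reflections_def)
    have ws: "w \<otimes>\<^bsub>W J\<^esub> s \<in> carrier (W J)"
      using w s J_W group_W by (metis group.is_monoid monoid.m_closed)
    then show "r \<in> carrier (W J)"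
      unfolding r using inv_W[OF w] group_W by (metis group.is_monoid monoid.m_closed)
    \<comment> \<open>As R = w Q and r R = w s Q, the map w carries a common member of Q and s Q to
      one of R and r R.\<close>
    define Q where "Q = (inv\<^bsub>W J\<^esub> w) ` R"
    have "Q \<inter> s ` Q \<noteq> {}"
      unfolding Q_def by (rule meets[OF s W_Omega[OF inv_W[OF w] R]])
    moreover have "w ` Q = R"
      using comp_inv_W(1)[OF w] by (simp add: Q_def image_comp)
    moreover have "r ` R = w ` s ` Q"
      unfolding r Q_def mult_W[OF ws inv_W[OF w]] unfolding mult_W[OF w J_W[OF s]]
      by (simp add: image_comp comp_assoc)
    ultimately show "R \<inter> r ` R \<noteq> {}" by blast
  qed
  show ?thesis
    unfolding QP_triple_def quasiparabolic_def scaled_set_def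
  proof (intro conjI ballI impI)
    fix s R assume s: "s \<in> J" and R: "R \<in> Omega U"
    show "\<bar>int (rho U (restrict (std_act s) (Omega U) R)) - int (rho U R)\<bar> \<le> 1"
      unfolding act[OF J_W[OF s] R] by (rule level_step[OF s R])
  next
    fix r R assume r: "r \<in> conjugate_reflections (W J) J" and R: "R \<in> Omega U"
      and "int (rho U (restrict (std_act r) (Omega U) R)) = int (rho U R)"
    then have "rho U (r ` R) = rho U R"
      using act[OF reflection(1)[OF r R] R] by simp
    then show "restrict (std_act r) (Omega U) R = R"
      unfolding act[OF reflection(1)[OF r R] R]
      using qp1[OF R W_Omega[OF reflection(1)[OF r R] R] reflection(2)[OF r R]] by blast
  next
    fix r s R assume r: "r \<in> conjugate_reflections (W J) J" and s: "s \<in> J" and R: "R \<in> Omega U"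
    note rR = W_Omega[OF reflection(1)[OF r R] R]
    note acts = act[OF reflection(1)[OF r R] R] act[OF J_W[OF s] R] act[OF J_W[OF s] rR]
    assume "int (rho U R) < int (rho U (restrict (std_act r) (Omega U) R)) \<and>
      int (rho U (restrict (std_act s) (Omega U) (restrict (std_act r) (Omega U) R)))
        < int (rho U (restrict (std_act s) (Omega U) R))"
    then show "restrict (std_act r) (Omega U) R = restrict (std_act s) (Omega U) R"
      unfolding acts using qp2[OF s R rR reflection(2)[OF r R]] by simp
  qed (use J U action generators_W[OF J] in auto)
qed

section \<open>The 27 roots and their orthogonal triples\<close>

text \<open>
  \<open>Weight c\<^sub>1 \<dots> c\<^sub>6\<close> stands for the root \<open>c\<^sub>1 \<alpha>\<^sub>1 + \<dots> + c\<^sub>6 \<alpha>\<^sub>6 + \<alpha>\<^sub>7\<close>; the coefficient of \<open>\<alpha>\<^sub>7\<close> accounts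
  for the constants in the following formulas.
\<close>

datatype weight = Weight int int int int int int

fun pairing :: "weight \<Rightarrow> weight \<Rightarrow> int" where
  "pairing (Weight a b c d e f) (Weight a' b' c' d' e' f') =
     2 * (a * a' + b * b' + c * c' + d * d' + e * e' + f * f' + 1)
     - (a * c' + c * a') - (c * d' + d * c') - (b * d' + d * b') - (d * e' + e * d')
     - (e * f' + f * e') - (f + f')"

text \<open>B(\<alpha>_i, x) is twice the i-th coefficient minus the neighbouring ones. Subtracting
  it from the i-th coefficient leaves the sum of the neighbours minus that coefficient.\<close>

fun refl1 :: "weight \<Rightarrow> weight" where "refl1 (Weight a b c d e f) = Weight (c - a) b c d e f"
fun refl2 :: "weight \<Rightarrow> weight" where "refl2 (Weight a b c d e f) = Weight a (d - b) c d e f"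
fun refl3 :: "weight \<Rightarrow> weight" where "refl3 (Weight a b c d e f) = Weight a b (a + d - c) d e f"
fun refl4 :: "weight \<Rightarrow> weight" where "refl4 (Weight a b c d e f) = Weight a b c (b + c + e - d) e f"
fun refl5 :: "weight \<Rightarrow> weight" where "refl5 (Weight a b c d e f) = Weight a b c d (d + f - e) f"
fun refl6 :: "weight \<Rightarrow> weight" where "refl6 (Weight a b c d e f) = Weight a b c d e (e + 1 - f)"

text \<open>When \<open>pairing p q\<close> is 1, reflecting q in p gives q - p, which is positive
  exactly if p is below q; the coefficients of \<alpha>_7 cancel.\<close>

fun below :: "weight \<Rightarrow> weight \<Rightarrow> bool" where
  "below (Weight a b c d e f) (Weight a' b' c' d' e' f') \<longleftrightarrow>
     a \<le> a' \<and> b \<le> b' \<and> c \<le> c' \<and> d \<le> d' \<and> e \<le> e' \<and> f \<le> f'"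

fun coefficient_sum :: "weight \<Rightarrow> int" where
  "coefficient_sum (Weight a b c d e f) = a + b + c + d + e + f"

definition refls :: "(weight \<Rightarrow> weight) list" where
  "refls = [refl1, refl2, refl3, refl4, refl5, refl6]"

text \<open>Listed by increasing \<open>coefficient_sum\<close>, from \<alpha>_7 to the highest root
  of the E7 subsystem.\<close>

definition weights :: "weight list" where
  "weights =
    [Weight 0 0 0 0 0 0, Weight 0 0 0 0 0 1, Weight 0 0 0 0 1 1, Weight 0 0 0 1 1 1,
     Weight 0 0 1 1 1 1, Weight 0 1 0 1 1 1, Weight 0 1 1 1 1 1, Weight 1 0 1 1 1 1,
     Weight 0 1 1 2 1 1, Weight 1 1 1 1 1 1, Weight 0 1 1 2 2 1, Weight 1 1 1 2 1 1,
     Weight 0 1 1 2 2 2, Weight 1 1 1 2 2 1, Weight 1 1 2 2 1 1, Weight 1 1 1 2 2 2,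
     Weight 1 1 2 2 2 1, Weight 1 1 2 2 2 2, Weight 1 1 2 3 2 1, Weight 1 1 2 3 2 2,
     Weight 1 2 2 3 2 1, Weight 1 1 2 3 3 2, Weight 1 2 2 3 2 2, Weight 1 2 2 3 3 2,
     Weight 1 2 2 4 3 2, Weight 1 2 3 4 3 2, Weight 2 2 3 4 3 2]"

section \<open>Orthogonal triples as cliques\<close>

fun cliques :: "('a \<Rightarrow> 'a \<Rightarrow> bool) \<Rightarrow> nat \<Rightarrow> 'a list \<Rightarrow> 'a list list" where
  "cliques P 0 ps = [[]]"
| "cliques P (Suc k) [] = []"
| "cliques P (Suc k) (p # ps) = map ((#) p) (cliques P k (filter (P p) ps)) @ cliques P (Suc k) ps"

definition perp :: "weight \<Rightarrow> weight \<Rightarrow> bool" where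
  "perp p q \<longleftrightarrow> pairing p q = 0"

text \<open>The size is written with \<open>Suc\<close>, the form on which the equations of
  \<open>cliques\<close> recurse.\<close>

definition triangles :: "weight list list" where
  "triangles = cliques perp (Suc (Suc (Suc 0))) weights"

text \<open>This is \<open>rho\<close> in coordinates: the condition on p and q says that reflecting
  q in p gives a positive root.\<close>

definition level :: "weight list \<Rightarrow> nat" where
  "level t = length (filter (\<lambda>q. \<forall>p\<in>set t. pairing p q = 0 \<or> pairing p q = 1 \<and> below p q) weights)"

text \<open>The tail of a clique is drawn from the later neighbours of its head. Distinctness keeps
  the head out of the tail, and symmetry gives adjacency in both directions.\<close>

lemma cliques_sound:
  "distinct ps \<Longrightarrow> symp P \<Longrightarrow> t \<in> set (cliques P k ps) \<Longrightarrow>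
     set t \<subseteq> set ps \<and> card (set t) = k \<and> pairwise P (set t)"
proof (induction P k ps arbitrary: t rule: cliques.induct)
  case (3 P k p ps)
  show ?case
  proof (cases "t \<in> set (cliques P (Suc k) ps)")
    case True
    then show ?thesis using 3 by auto
  next
    case False
    then obtain u where t: "t = p # u" and u: "u \<in> set (cliques P k (filter (P p) ps))"
      using 3(5) by auto
    have *: "set u \<subseteq> set (filter (P p) ps)" "card (set u) = k" "pairwise P (set u)"
      using 3(1)[OF _ 3(4) u] 3(3) by auto
    moreover have "p \<notin> set u" using *(1) 3(3) by auto
    ultimately show ?thesis
      using 3(4) by (auto simp: t pairwise_insert dest: sympD)
  qed
qed auto

text \<open>If the head p lies in T, the rest of T survives the filter, being adjacent to p;
  otherwise T is found in the tail.\<close>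

lemma cliques_complete:
  "finite T \<Longrightarrow> T \<subseteq> set ps \<Longrightarrow> card T = k \<Longrightarrow> pairwise P T \<Longrightarrow> symp P \<Longrightarrow>
     \<exists>t\<in>set (cliques P k ps). set t = T"
proof (induction P k ps arbitrary: T rule: cliques.induct)
  case (3 P k p ps)
  show ?case
  proof (cases "p \<in> T")
    case True
    have "T - {p} \<subseteq> set (filter (P p) ps)"
      using 3(4,6) True by (auto simp: pairwise_def)
    moreover have "card (T - {p}) = k" "pairwise P (T - {p})"
      using 3(5,6) True by (auto simp: pairwise_def)
    ultimately obtain u where "u \<in> set (cliques P k (filter (P p) ps))" "set u = T - {p}"
      using 3(1)[of "T - {p}"] 3(3,7) by blast
    then have "p # u \<in> set (cliques P (Suc k) (p # ps))" "set (p # u) = T"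
      using True by auto
    then show ?thesis by blast
  next
    case False
    then have "T \<subseteq> set ps" using 3(4) by auto
    then obtain u where "u \<in> set (cliques P (Suc k) ps)" "set u = T"
      using 3 by blast
    then show ?thesis by auto
  qed
qed auto

lemma pairing_commute: "pairing p q = pairing q p"
  by (cases p; cases q) (simp add: algebra_simps)

lemma symp_perp: "symp perp"
  by (simp add: symp_def perp_def pairing_commute)

section \<open>Finite checks on the 27 coefficient vectors\<close>

text \<open>The box is that of \<open>weight_bounds\<close>; the last member of
  \<open>weights\<close> attains all its upper limits.\<close>

lemma weights_complete:
  "\<forall>a\<in>set [0..2]. \<forall>b\<in>set [0..2]. \<forall>c\<in>set [0..3]. \<forall>d\<in>set [0..4]. \<forall>e\<in>set [0..3]. \<forall>f\<in>set [0..2].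
     pairing (Weight a b c d e f) (Weight a b c d e f) = 2 \<longrightarrow> Weight a b c d e f \<in> set weights"
  by code_simp

lemma refls_weights: "\<forall>s\<in>set refls. \<forall>p\<in>set weights. s p \<in> set weights"
  by code_simp

text \<open>This drives the induction in \<open>to_root_in_roots\<close>; nonnegative sums make the
  descent strict after applying \<open>nat\<close>.\<close>

lemma refls_descend:
  "\<forall>p\<in>set weights. p \<noteq> Weight 0 0 0 0 0 0 \<longrightarrow>
     (\<exists>t\<in>set refls. t p \<in> set weights \<and> 0 \<le> coefficient_sum (t p) \<and>
       coefficient_sum (t p) < coefficient_sum p)"
  by code_simp

text \<open>Roots of 8-height 0 have 7-height at most 1, so the sum of two members is never a root
  and no pairing is negative.\<close>

lemma pairing_weights:
  "\<forall>p\<in>set weights. \<forall>q\<in>set weights.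
     pairing p q = 0 \<or> pairing p q = 1 \<or> pairing p q = 2 \<and> p = q"
  by code_simp

text \<open>Orthogonal members correspond to meeting lines on the cubic surface, and a line outside
  a tritangent plane meets just one of the three lines in it.\<close>

lemma no_orthogonal_quadruple: "cliques perp (Suc (Suc (Suc (Suc 0)))) weights = []"
  by code_simp

lemma triangles_nonempty: "triangles \<noteq> []"
  by code_simp

text \<open>The sum of an orthogonal triple is orthogonal to \<alpha>_1, ..., \<alpha>_6. The
  products of its members with \<alpha>_i lie in {-1, 0, 1} and add up to 0, so one of them is 0 and
  s_i fixes that member.\<close>

lemma level_refls:
  "\<forall>x\<in>set triangles. \<forall>s\<in>set refls.
     level (map s x) \<le> Suc (level x) \<and> level x \<le> Suc (level (map s x)) \<and> (\<exists>p\<in>set x. s p \<in> set x)"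
  by code_simp

text \<open>
  The levels of a triple and of its images are stored together, so that the comparison of all pairs
  of triples computes each level only once.
\<close>

definition profile :: "weight list \<Rightarrow> weight list \<times> nat \<times> (weight list \<times> nat) list" where
  "profile x = (x, level x, map (\<lambda>t. (map t x, level (map t x))) refls)"

text \<open>The two conclusions are (QP1) and (QP2), with y in the role of the image of x under a
  reflection.\<close>

fun compatible ::
    "weight list \<times> nat \<times> (weight list \<times> nat) list \<Rightarrow>
     weight list \<times> nat \<times> (weight list \<times> nat) list \<Rightarrow> bool" where
  "compatible (x, lx, sx) (y, ly, sy) \<longleftrightarrow> ((\<exists>p\<in>set x. p \<in> set y) \<longrightarrow>
     (lx = ly \<longrightarrow> set x = set y) \<and>
     (lx < ly \<longrightarrow> list_all2 (\<lambda>(x', lx') (y', ly'). ly' < lx' \<longrightarrow> set y = set x') sx sy))"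

lemma triangles_compatible:
  "let ps = map profile triangles in \<forall>X\<in>set ps. \<forall>Y\<in>set ps. compatible X Y"
  by code_simp

lemma distinct_weights: "distinct weights"
  by (simp add: weights_def)

section \<open>From coefficient vectors to roots\<close>

fun to_root :: "weight \<Rightarrow> lattice" where
  "to_root (Weight a b c d e f) = (\<chi> i. if i = 1 then a else if i = 2 then b else if i = 3 then c
     else if i = 4 then d else if i = 5 then e else if i = 6 then f else if i = 7 then 1 else 0)"

lemma to_root_nth [simp]:
  "to_root (Weight a b c d e f) $ 1 = a" "to_root (Weight a b c d e f) $ 2 = b"
  "to_root (Weight a b c d e f) $ 3 = c" "to_root (Weight a b c d e f) $ 4 = d"
  "to_root (Weight a b c d e f) $ 5 = e" "to_root (Weight a b c d e f) $ 6 = f"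
  "to_root (Weight a b c d e f) $ 7 = 1" "to_root (Weight a b c d e f) $ 8 = 0"
  by (simp_all add: eq_numeral_iff_iszero)

declare to_root.simps [simp del]

lemma inj_to_root: "inj to_root"
proof (rule injI)
  fix p q :: weight
  assume "to_root p = to_root q"
  then show "p = q"
    by (cases p; cases q) (simp add: vec_eq_iff all_8)
qed

lemma B_to_root: "B (to_root p) (to_root q) = pairing p q"
  by (cases p; cases q) (simp add: B_coordinates algebra_simps)

lemma simple_refl_to_root:
  "simple_refl 1 (to_root p) = to_root (refl1 p)" "simple_refl 2 (to_root p) = to_root (refl2 p)"
  "simple_refl 3 (to_root p) = to_root (refl3 p)" "simple_refl 4 (to_root p) = to_root (refl4 p)"
  "simple_refl 5 (to_root p) = to_root (refl5 p)" "simple_refl 6 (to_root p) = to_root (refl6 p)"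
  by (cases p; simp add: vec_eq_iff all_8 simple_refl_def refl_in_def B_coordinates simple_root_def
      axis_def eq_numeral_iff_iszero)+

lemma refls_simple_refl:
  assumes "t \<in> set refls"
  shows "\<exists>i. \<forall>p. simple_refl i (to_root p) = to_root (t p)"
  using assms simple_refl_to_root by (auto simp: refls_def)

lemma reflection_refls:
  assumes "s \<in> S - {simple_refl 7, simple_refl 8}"
  shows "\<exists>t\<in>set refls. \<forall>p. s (to_root p) = to_root (t p)"
proof -
  obtain i where i: "s = simple_refl i" "i \<noteq> 7" "i \<noteq> 8"
    using assms by (auto simp: S_def)
  have "i \<in> {1, 2, 3, 4, 5, 6, 7, 8}" using UNIV_8 by blast
  then show ?thesis
    using i simple_refl_to_root by (auto simp: refls_def)
qed

lemma weight_bounds: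
  assumes norm: "pairing (Weight a b c d e f) (Weight a b c d e f) = 2"
  shows "a \<le> 2" "b \<le> 2" "c \<le> 3" "d \<le> 4" "e \<le> 3" "f \<le> 2"
proof -
  txt \<open>Completing the square for the variables in the order \<open>a, b, c, d, e, f\<close>.\<close>
  have "5 * (3 * f - 4)^2 + 3 * (4 * e - 5 * f)^2 + 2 * (5 * d - 6 * e)^2 + 10 * (3 * c - 2 * d)^2
      + 30 * (2 * b - d)^2 + 30 * (2 * a - c)^2 = 80"
    using norm by (simp add: power2_eq_square algebra_simps)
  moreover have "0 \<le> (3 * f - 4)^2" "0 \<le> (4 * e - 5 * f)^2" "0 \<le> (5 * d - 6 * e)^2"
    "0 \<le> (3 * c - 2 * d)^2" "0 \<le> (2 * b - d)^2" "0 \<le> (2 * a - c)^2" by simp_all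
  \<comment> \<open>Each square is at most 80 divided by its factor; the limits are larger perfect
    squares, so that roots can be taken.\<close>
  ultimately have "(3 * f - 4)^2 < 25" "(4 * e - 5 * f)^2 < 36" "(5 * d - 6 * e)^2 < 49"
    "(3 * c - 2 * d)^2 < 16" "(2 * b - d)^2 < 4" "(2 * a - c)^2 < 9"
    by linarith+
  then have "3 * f - 4 < 5" "4 * e - 5 * f < 6" "5 * d - 6 * e < 7" "3 * c - 2 * d < 4"
    "2 * b - d < 2" "2 * a - c < 3"
    using power2_less_imp_less[of "3 * f - 4" 5] power2_less_imp_less[of "4 * e - 5 * f" 6]
      power2_less_imp_less[of "5 * d - 6 * e" 7] power2_less_imp_less[of "3 * c - 2 * d" 4]
      power2_less_imp_less[of "2 * b - d" 2] power2_less_imp_less[of "2 * a - c" 3]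
    by simp_all
  \<comment> \<open>Back substitution: f is alone in its square, then f bounds e, e bounds d, d
    bounds b and c, and c bounds a.\<close>
  moreover from this show f: "f \<le> 2" by linarith
  moreover from calculation show e: "e \<le> 3" by linarith
  moreover from calculation show d: "d \<le> 4" by linarith
  moreover from calculation show c: "c \<le> 3" by linarith
  ultimately show "b \<le> 2" "a \<le> 2" by linarith+
qed

text \<open>Simple reflections lower every member down to \<alpha>_7, and each step is undone by the
  same reflection, which preserves the roots.\<close>

lemma to_root_in_roots: "p \<in> set weights \<Longrightarrow> to_root p \<in> roots"
proof (induction "nat (coefficient_sum p)" arbitrary: p rule: less_induct)
  case less
  show ?case
  proof (cases "p = Weight 0 0 0 0 0 0")
    case True
    then have "to_root p = simple_root 7"
      by (simp add: vec_eq_iff all_8 simple_root_def axis_def eq_numeral_iff_iszero)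
    then show ?thesis by (simp add: simple_root_in_roots)
  next
    case False
    then obtain t where t: "t \<in> set refls" "t p \<in> set weights" "0 \<le> coefficient_sum (t p)"
      "coefficient_sum (t p) < coefficient_sum p"
      using refls_descend less.prems by blast
    then obtain i where "simple_refl i (to_root p) = to_root (t p)"
      using refls_simple_refl by blast
    then have "to_root p = simple_refl i (to_root (t p))"
      using refl_in_involution[OF B_simple_root, of i] by (metis simple_refl_def)
    then show ?thesis
      using less.hyps[of "t p"] t refl_in_roots[OF simple_root_in_roots] by (simp add: simple_refl_def)
  qed
qed

abbreviation weight_roots :: "lattice set" where
  "weight_roots \<equiv> to_root ` set weights"

text \<open>A root has norm 2, which confines its coefficients to a finite box that has been
  searched.\<close>

lemma weight_roots_eq: "{\<alpha> \<in> pos_roots. height 8 \<alpha> = 0 \<and> height 7 \<alpha> = 1} = weight_roots"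
proof (intro equalityI subsetI)
  fix \<alpha> assume "\<alpha> \<in> {\<alpha> \<in> pos_roots. height 8 \<alpha> = 0 \<and> height 7 \<alpha> = 1}"
  then have \<alpha>: "\<alpha> \<in> roots" "\<And>i. 0 \<le> \<alpha> $ i" "\<alpha> $ 8 = 0" "\<alpha> $ 7 = 1"
    by (auto simp: pos_roots_def height_def)
  obtain a b c d e f where p: "a = \<alpha> $ 1" "b = \<alpha> $ 2" "c = \<alpha> $ 3" "d = \<alpha> $ 4" "e = \<alpha> $ 5" "f = \<alpha> $ 6"
    by blast
  have to_root: "\<alpha> = to_root (Weight a b c d e f)"
    using \<alpha>(3,4) by (simp add: vec_eq_iff all_8 p)
  then have norm: "pairing (Weight a b c d e f) (Weight a b c d e f) = 2"
    using B_root[OF \<alpha>(1)] B_to_root by metis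
  have "a \<in> set [0..2]" "b \<in> set [0..2]" "c \<in> set [0..3]" "d \<in> set [0..4]" "e \<in> set [0..3]"
    "f \<in> set [0..2]"
    using weight_bounds[OF norm] \<alpha>(2) by (simp_all add: p)
  then have "Weight a b c d e f \<in> set weights"
    using weights_complete norm by blast
  then show "\<alpha> \<in> weight_roots" using to_root by blast
next
  fix \<alpha> assume "\<alpha> \<in> weight_roots"
  then obtain p where p: "p \<in> set weights" "\<alpha> = to_root p" by blast
  then have "\<forall>i. 0 \<le> \<alpha> $ i" "\<alpha> $ 8 = 0" "\<alpha> $ 7 = 1"
    by (auto simp: weights_def all_8)
  then show "\<alpha> \<in> {\<alpha> \<in> pos_roots. height 8 \<alpha> = 0 \<and> height 7 \<alpha> = 1}"
    using to_root_in_roots p by (simp add: pos_roots_def height_def)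
qed

lemma refl_in_to_root_pos:
  assumes "p \<in> set weights" "q \<in> set weights"
  shows "refl_in (to_root p) (to_root q) \<in> pos_roots \<longleftrightarrow>
    pairing p q = 0 \<or> pairing p q = 1 \<and> below p q"
proof -
  have pos: "0 \<le> to_root q $ i" for i
    using weight_roots_eq assms(2) by (fastforce simp: pos_roots_def)
  have "refl_in (to_root p) (to_root q) \<in> roots"
    using assms to_root_in_roots refl_in_roots by blast
  then have "refl_in (to_root p) (to_root q) \<in> pos_roots \<longleftrightarrow>
      (\<forall>i. pairing p q * to_root p $ i \<le> to_root q $ i)"
    by (simp add: pos_roots_def refl_in_def B_to_root)
  moreover have "(\<forall>i. to_root p $ i \<le> to_root q $ i) \<longleftrightarrow> below p q"
    by (cases p; cases q) (simp add: all_8)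
  \<comment> \<open>This excludes pairing 2, that is p = q: the reflected root would be -q, negative
    at \<alpha>_7.\<close>
  moreover have "\<not> 2 * to_root q $ 7 \<le> to_root q $ 7"
    by (cases q) simp
  ultimately show ?thesis
    using pairing_weights assms pos by fastforce
qed

section \<open>Levels and maximal orthogonal sets in coordinates\<close>

lemma rho_to_root:
  assumes "set x \<subseteq> set weights"
  shows "rho weight_roots (to_root ` set x) = level x"
proof -
  let ?ok = "\<lambda>q. \<forall>p\<in>set x. pairing p q = 0 \<or> pairing p q = 1 \<and> below p q"
  have "(\<forall>\<beta>\<in>to_root ` set x. refl_in \<beta> (to_root q) \<in> pos_roots) \<longleftrightarrow> ?ok q" if "q \<in> set weights" for q
    using assms refl_in_to_root_pos[OF _ that] by blast
  then have "Res weight_roots (to_root ` set x) = to_root ` {q \<in> set weights. ?ok q}"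
    unfolding Res_def by blast
  then have "rho weight_roots (to_root ` set x) = card {q \<in> set weights. ?ok q}"
    using inj_to_root by (simp add: rho_def card_image inj_on_subset)
  also have "\<dots> = card (set (filter ?ok weights))" by simp
  also have "\<dots> = level x"
    unfolding level_def using distinct_weights by (intro distinct_card) simp
  finally show ?thesis .
qed

text \<open>\<open>pairwise\<close> tests distinct elements only, and injectivity of
  \<open>to_root\<close> makes distinctness agree on both sides.\<close>

lemma orthogonal_sets_weight_roots:
  "orthogonal_sets weight_roots = (\<lambda>T. to_root ` T) ` {T. T \<subseteq> set weights \<and> pairwise perp T}"
proof -
  have "pairwise (\<lambda>\<alpha> \<beta>. B \<alpha> \<beta> = 0) (to_root ` T) \<longleftrightarrow> pairwise perp T" for T
    using inj_to_root by (auto simp: pairwise_def B_to_root perp_def inj_eq)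
  then show ?thesis
    unfolding orthogonal_sets_def by (auto simp: subset_image_iff)
qed

lemma card_orthogonal:
  assumes "T \<subseteq> set weights" "pairwise perp T"
  shows "card T \<le> 3"
proof (rule ccontr)
  assume "\<not> card T \<le> 3"
  then obtain Q where Q: "Q \<subseteq> T" "card Q = Suc (Suc (Suc (Suc 0)))" "finite Q"
    using obtain_subset_with_card_n[of 4 T] by (auto simp: numeral_eq_Suc)
  then have "Q \<subseteq> set weights" "pairwise perp Q"
    using assms pairwise_subset by blast+
  from cliques_complete[OF Q(3) this(1) Q(2) this(2) symp_perp] show False
    by (simp only: no_orthogonal_quadruple) simp
qed

lemma triangles_iff:
  "(\<exists>t\<in>set triangles. set t = T) \<longleftrightarrow> T \<subseteq> set weights \<and> pairwise perp T \<and> card T = 3"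
proof
  assume "\<exists>t\<in>set triangles. set t = T"
  then show "T \<subseteq> set weights \<and> pairwise perp T \<and> card T = 3"
    using cliques_sound[OF distinct_weights symp_perp] unfolding triangles_def by fastforce
next
  assume T: "T \<subseteq> set weights \<and> pairwise perp T \<and> card T = 3"
  moreover have "finite T" using T finite_subset by blast
  ultimately show "\<exists>t\<in>set triangles. set t = T"
    unfolding triangles_def using symp_perp by (intro cliques_complete) auto
qed

lemma kappa_weight_roots: "kappa weight_roots = 3"
  unfolding kappa_def
proof (rule Max_eqI)
  have card: "card (to_root ` T) = card T" for T
    using inj_to_root by (simp add: card_image inj_on_subset)
  show "finite (card ` orthogonal_sets weight_roots)"
    by (rule finite_subset[of _ "{..3}"])
      (auto simp: orthogonal_sets_weight_roots card card_orthogonal)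
  show "n \<le> 3" if "n \<in> card ` orthogonal_sets weight_roots" for n
    using that by (auto simp: orthogonal_sets_weight_roots card card_orthogonal)
  obtain t where "t \<in> set triangles" using triangles_nonempty by (meson last_in_set)
  then have "set t \<subseteq> set weights \<and> pairwise perp (set t) \<and> card (set t) = 3"
    using triangles_iff by blast
  then have "to_root ` set t \<in> orthogonal_sets weight_roots" "card (to_root ` set t) = 3"
    by (auto simp: orthogonal_sets_weight_roots card)
  then show "3 \<in> card ` orthogonal_sets weight_roots" by (metis imageI)
qed

lemma Omega_weight_roots: "Omega weight_roots = (\<lambda>t. to_root ` set t) ` set triangles"
proof -
  have card: "card (to_root ` T) = card T" for T
    using inj_to_root by (simp add: card_image inj_on_subset)
  have "Omega weight_roots = (\<lambda>T. to_root ` T) ` {T. T \<subseteq> set weights \<and> pairwise perp T \<and> card T = 3}"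
    unfolding Omega_def kappa_weight_roots orthogonal_sets_weight_roots by (auto simp: card)
  also have "{T. T \<subseteq> set weights \<and> pairwise perp T \<and> card T = 3} = set ` set triangles"
    by (auto simp: triangles_iff[symmetric])
  finally show ?thesis by (simp add: image_image)
qed

section \<open>The axioms for intersecting triples\<close>

lemma compatible_triangles:
  assumes "x \<in> set triangles" "y \<in> set triangles" "set x \<inter> set y \<noteq> {}"
  shows "level x = level y \<Longrightarrow> set x = set y"
    and "t \<in> set refls \<Longrightarrow> level x < level y \<Longrightarrow> level (map t y) < level (map t x) \<Longrightarrow>
      set y = set (map t x)"
proof -
  have "compatible (profile x) (profile y)"
    using triangles_compatible assms(1,2) by (simp add: Let_def)
  have "(level x = level y \<longrightarrow> set x = set y) \<and> (level x < level y \<longrightarrow>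
      (\<forall>t\<in>set refls. level (map t y) < level (map t x) \<longrightarrow> set y = set (map t x)))"
    using \<open>compatible (profile x) (profile y)\<close> assms(3)
    \<comment> \<open>Both lists of images are maps over \<open>refls\<close>, so
      \<open>list_all2\<close> compares images under the same reflection.\<close>
    by (auto simp: profile_def list_all2_map1 list_all2_map2 list_all2_same)
  then show "level x = level y \<Longrightarrow> set x = set y"
    and "t \<in> set refls \<Longrightarrow> level x < level y \<Longrightarrow> level (map t y) < level (map t x) \<Longrightarrow>
      set y = set (map t x)"
    by blast+
qed

theorem theorem5p13:
  shows "QP_triple (S - {simple_refl 7, simple_refl 8})
           {\<alpha> \<in> pos_roots. height 8 \<alpha> = 0 \<and> height 7 \<alpha> = 1}"
  unfolding weight_roots_eq
proof (rule QP_triple_criterion)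
  have triangle: "set x \<subseteq> set weights" if "x \<in> set triangles" for x
    using triangles_iff[of "set x"] that by auto
  show "weight_roots \<subseteq> pos_roots" using weight_roots_eq by blast
  show "S - {simple_refl 7, simple_refl 8} \<subseteq> S" by blast
  {
    \<comment> \<open>Four hypotheses of the criterion concern a simple reflection s; they share its
      coordinate form t.\<close>
    fix s assume "s \<in> S - {simple_refl 7, simple_refl 8}"
    then obtain t where t: "t \<in> set refls" "\<forall>p. s (to_root p) = to_root (t p)"
      using reflection_refls by blast
    have image: "s ` to_root ` set x = to_root ` set (map t x)" for x
      using t(2) by (simp add: image_image)
    have level: "rho weight_roots (to_root ` set x) = level x"
      "rho weight_roots (s ` to_root ` set x) = level (map t x)" if "x \<in> set triangles" for x
    proof -
      show "rho weight_roots (to_root ` set x) = level x"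
        using triangle[OF that] by (rule rho_to_root)
      have "set (map t x) \<subseteq> set weights"
        using triangle[OF that] refls_weights t(1) by auto
      then show "rho weight_roots (s ` to_root ` set x) = level (map t x)"
        unfolding image by (rule rho_to_root)
    qed
    show "s ` weight_roots \<subseteq> weight_roots"
      using refls_weights t by auto
    show "\<bar>int (rho weight_roots (s ` R)) - int (rho weight_roots R)\<bar> \<le> 1" "R \<inter> s ` R \<noteq> {}"
      if "R \<in> Omega weight_roots" for R
    proof -
      obtain x where x: "x \<in> set triangles" "R = to_root ` set x"
        using \<open>R \<in> _\<close> by (auto simp: Omega_weight_roots)
      then have "level (map t x) \<le> Suc (level x)" "level x \<le> Suc (level (map t x))"
        and meets: "\<exists>p\<in>set x. t p \<in> set x"
        using level_refls t(1) by blast+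
      then show "\<bar>int (rho weight_roots (s ` R)) - int (rho weight_roots R)\<bar> \<le> 1"
        unfolding x(2) level[OF x(1)] by linarith
      show "R \<inter> s ` R \<noteq> {}"
        unfolding x(2) image using meets by auto
    qed
    show "T = s ` R" if "R \<in> Omega weight_roots" "T \<in> Omega weight_roots" "R \<inter> T \<noteq> {}"
      "rho weight_roots R < rho weight_roots T" "rho weight_roots (s ` T) < rho weight_roots (s ` R)"
      for R T
    proof -
      obtain x y where x: "x \<in> set triangles" "R = to_root ` set x"
        and y: "y \<in> set triangles" "T = to_root ` set y"
        using \<open>R \<in> _\<close> \<open>T \<in> _\<close> by (auto simp: Omega_weight_roots)
      have "set x \<inter> set y \<noteq> {}"
        using \<open>R \<inter> T \<noteq> {}\<close> inj_to_root by (auto simp: x y inj_eq)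
      then have "set y = set (map t x)"
        using compatible_triangles(2)[OF x(1) y(1) _ t(1)] that(4,5)
        unfolding x(2) y(2) level[OF x(1)] level[OF y(1)] by blast
      then show ?thesis unfolding x(2) y(2) image by simp
    qed
  }
  show "T = R" if "R \<in> Omega weight_roots" "T \<in> Omega weight_roots" "R \<inter> T \<noteq> {}"
    "rho weight_roots T = rho weight_roots R" for R T
  proof -
    obtain x y where x: "x \<in> set triangles" "R = to_root ` set x"
      and y: "y \<in> set triangles" "T = to_root ` set y"
      using \<open>R \<in> _\<close> \<open>T \<in> _\<close> by (auto simp: Omega_weight_roots)
    have "set x \<inter> set y \<noteq> {}"
      using \<open>R \<inter> T \<noteq> {}\<close> inj_to_root by (auto simp: x y inj_eq)
    then show ?thesis
      using compatible_triangles(1)[OF x(1) y(1)] that(4) rho_to_root triangle x y by simp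
  qed
qed

end
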